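(* Let $n\ge1$, $r\in[1:n]$, and let $A\subseteq\{-1,1\}^n$ be a code of size $M\ge1$, $\alpha=M/2^n$. Then \[ \sum_{i=2}^nQ^{(A)}(i)(\omega_1-\omega_i)\ge\overline\Lambda_n(\alpha,r). \]
   Context: $[a:b]$ is the set of integers in $[a,b]$. Krawtchouk polynomials: $K_k(x)=K_k^{(n)}(x)=\sum_{j=0}^k(-1)^j\binom xj\binom{n-x}{k-j}$ (generalized binomial coefficients, $\binom xj=0$ for $j<0$). For $S\subseteq[1:n]$, $\chi_S(\mathbf{x})=\prod_{i\in S}x_i$; for $f:\{-1,1\}^n\to\mathbb R$, $\hat f_S=\mathbb E[f(\mathbf X)\chi_S(\mathbf X)]$ with $\mathbf X\sim\mathrm{Unif}\{-1,1\}^n$, and $\mathbf W_k[f]=\sum_{|S|=k}\hat f_S^2$. For a code $A$ with $\alpha=|A|/2^n$, $Q^{(A)}(k)=\mathbf W_k[1_A]/\alpha^2$. Let $\omega_i=\sum_{k=0}^rK_k(i)$ for $i\in[0:n]$. Define $\overline\Lambda_n(\alpha,r)$ as the optimal value of the linear program: maximize $-\sum_{k=1}^n[K_k(0)+K_k(1)(\frac1\alpha-1)]x_k$ over $x_1,\dots,x_n\ge0$ subject to $\sum_{k=1}^n[K_k(1)-K_k(i)]x_k\ge-(\omega_1-\omega_i)$ for all $i\in[2:n]$. *)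

theory Defs
  imports "HOL-Probability.Probability"
begin

definition krawtchouk :: "nat \<Rightarrow> nat \<Rightarrow> real \<Rightarrow> real" where
  "krawtchouk n k x = (\<Sum>j=0..k. (- 1) ^ j * (x gchoose j) * ((real n - x) gchoose (k - j)))"

text \<open>Points of \<open>{-1,1}\<^sup>n\<close> are extensional functions on \<open>{1..n}\<close>, so that distinct elements
  of the set are distinct points and its cardinality is \<open>2 ^ n\<close>.\<close>

definition cube :: "nat \<Rightarrow> (nat \<Rightarrow> real) set" where
  "cube n = {1..n} \<rightarrow>\<^sub>E {- 1, 1}"

definition chi :: "nat set \<Rightarrow> (nat \<Rightarrow> real) \<Rightarrow> real" where
  "chi S x = (\<Prod>i\<in>S. x i)"

definition fourier_coeff :: "nat \<Rightarrow> ((nat \<Rightarrow> real) \<Rightarrow> real) \<Rightarrow> nat set \<Rightarrow> real" where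
  "fourier_coeff n f S = measure_pmf.expectation (pmf_of_set (cube n)) (\<lambda>x. f x * chi S x)"

definition fourier_weight :: "nat \<Rightarrow> nat \<Rightarrow> ((nat \<Rightarrow> real) \<Rightarrow> real) \<Rightarrow> real" where
  "fourier_weight n k f = (\<Sum>S | S \<subseteq> {1..n} \<and> card S = k. (fourier_coeff n f S)\<^sup>2)"

definition code_density :: "nat \<Rightarrow> (nat \<Rightarrow> real) set \<Rightarrow> real" where
  "code_density n A = real (card A) / 2 ^ n"

definition dual_distribution :: "nat \<Rightarrow> (nat \<Rightarrow> real) set \<Rightarrow> nat \<Rightarrow> real" where
  "dual_distribution n A k = fourier_weight n k (indicator A) / (code_density n A)\<^sup>2"

definition omega :: "nat \<Rightarrow> nat \<Rightarrow> nat \<Rightarrow> real" where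
  "omega n r i = (\<Sum>k=0..r. krawtchouk n k (real i))"

text \<open>Only the coordinates \<open>x 1, \<dots>, x n\<close> of \<open>x\<close> matter in the following linear program.\<close>

definition lp_feasible :: "nat \<Rightarrow> nat \<Rightarrow> (nat \<Rightarrow> real) set" where
  "lp_feasible n r = {x. (\<forall>k\<in>{1..n}. x k \<ge> 0) \<and>
     (\<forall>i\<in>{2..n}. (\<Sum>k=1..n. (krawtchouk n k 1 - krawtchouk n k (real i)) * x k)
                   \<ge> - (omega n r 1 - omega n r i))}"

definition lp_objective :: "nat \<Rightarrow> real \<Rightarrow> (nat \<Rightarrow> real) \<Rightarrow> real" where
  "lp_objective n \<alpha> x =
     - (\<Sum>k=1..n. (krawtchouk n k 0 + krawtchouk n k 1 * (1 / \<alpha> - 1)) * x k)"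

text \<open>The optimal value is an extended real: for arbitrary \<open>\<alpha>\<close> the program may be unbounded.\<close>

definition Lambda_bar :: "nat \<Rightarrow> real \<Rightarrow> nat \<Rightarrow> ereal" where
  "Lambda_bar n \<alpha> r = (SUP x\<in>lp_feasible n r. ereal (lp_objective n \<alpha> x))"

end

theory Submission
  imports Defs
begin

text \<open>Weak linear programming duality. The weights \<open>Q(i)\<close> are non-negative, \<open>Q(0) = 1\<close>,
  \<open>\<Sum>\<^sub>i Q(i) = 1 / \<alpha>\<close> by Parseval, and \<open>\<Sum>\<^sub>i Q(i) K\<^sub>k(i) \<ge> 0\<close> by Delsarte's inequalities, so that
  \<open>Q(2), \<dots>, Q(n)\<close> are dual feasible. For the last two facts, \<open>K\<^sub>k(|S|)\<close> is the sum of
  \<open>(-1)\<^bsup>|S \<inter> T|\<^esup>\<close> over the \<open>k\<close>-subsets \<open>T\<close>, and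
  \<open>4\<^sup>n \<Sum>\<^sub>S f\<^sub>S\<^sup>2 (-1)\<^bsup>|S \<inter> T|\<^esup>\<close> expands into the sum over \<open>x, y \<in> A\<close> of the products
  \<open>\<Prod>\<^sub>i (1 + x\<^sub>i y\<^sub>i \<sigma>\<^sub>i)\<close> of non-negative factors, where \<open>f\<^sub>S\<close> is the Fourier coefficient of the
  indicator of \<open>A\<close> and \<open>\<sigma>\<^sub>i = -1\<close> exactly for \<open>i \<in> T\<close>.\<close>

section \<open>Subset expansions and Krawtchouk polynomials\<close>

lemma sum_Pow_prod_eq_prod_one_plus:
  fixes f :: "'a \<Rightarrow> 'b :: comm_semiring_1"
  assumes "finite I"
  shows "(\<Sum>S\<in>Pow I. \<Prod>i\<in>S. f i) = (\<Prod>i\<in>I. 1 + f i)"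
  using assms
proof induction
  case (insert a I)
  have inj: "inj_on (insert a) (Pow I)"
    using insert.hyps(2) by (auto simp: inj_on_def)
  have "(\<Sum>S\<in>Pow (insert a I). prod f S) = (\<Sum>S\<in>Pow I. prod f S) + (\<Sum>S\<in>insert a ` Pow I. prod f S)"
    unfolding Pow_insert using insert.hyps by (intro sum.union_disjoint) auto
  also have "(\<Sum>S\<in>insert a ` Pow I. prod f S) = (\<Sum>S\<in>Pow I. prod f (insert a S))"
    using inj by (simp add: sum.reindex)
  also have "\<dots> = (\<Sum>S\<in>Pow I. f a * prod f S)"
    using insert.hyps by (intro sum.cong refl prod.insert) (auto intro: finite_subset)
  finally show ?case
    using insert by (simp add: sum_distrib_left [symmetric] algebra_simps)
qed simp

text \<open>The set \<open>T\<close> is determined by the pair \<open>(S \<inter> T, T - S)\<close>,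
  and the two components can be chosen independently. For \<open>j > k\<close> truncated subtraction
  would turn the second factor into 1, while no such \<open>T\<close> exists.\<close>

lemma card_subsets_card_Int:
  assumes "finite N" and "S \<subseteq> N" and "j \<le> k"
  shows "card {T. T \<subseteq> N \<and> card T = k \<and> card (S \<inter> T) = j}
           = (card S choose j) * (card N - card S choose (k - j))"
proof -
  have fin: "finite S" "finite (N - S)" using assms finite_subset by auto
  let ?X = "{B. B \<subseteq> S \<and> card B = j}" and ?Y = "{C. C \<subseteq> N - S \<and> card C = k - j}"
  have card_split: "card T = card (S \<inter> T) + card (T - S)" if "T \<subseteq> N" for T
    using card_Int_Diff [of T S] that assms(1) finite_subset by (auto simp: Int_commute)
  have card_Un: "card (B \<union> C) = card B + card C" if "B \<subseteq> S" "C \<subseteq> N - S" for B C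
    using that fin by (intro card_Un_disjoint) (auto intro: finite_subset)
  have "bij_betw (\<lambda>T. (S \<inter> T, T - S)) {T. T \<subseteq> N \<and> card T = k \<and> card (S \<inter> T) = j} (?X \<times> ?Y)"
  proof (rule bij_betw_byWitness [where f' = "\<lambda>(B, C). B \<union> C"])
    show "(\<lambda>(B, C). B \<union> C) ` (?X \<times> ?Y) \<subseteq> {T. T \<subseteq> N \<and> card T = k \<and> card (S \<inter> T) = j}"
    proof clarsimp
      fix B C assume *: "B \<subseteq> S" "C \<subseteq> N - S" "card C = k - card B" "j = card B"
      then have "S \<inter> (B \<union> C) = B" by auto
      with * assms show "B \<subseteq> N \<and> C \<subseteq> N \<and> card (B \<union> C) = k \<and> card (S \<inter> (B \<union> C)) = card B"
        using card_Un [of B C] by auto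
    qed
  qed (use card_split in auto)
  then have "card {T. T \<subseteq> N \<and> card T = k \<and> card (S \<inter> T) = j} = card ?X * card ?Y"
    by (simp add: bij_betw_same_card card_cartesian_product)
  then show ?thesis
    using fin assms(2) by (simp add: n_subsets card_Diff_subset)
qed

text \<open>Grouping the sets \<open>T\<close> by \<open>j = card (S \<inter> T)\<close> recovers
  the defining sum term by term.\<close>

lemma krawtchouk_eq_sum_subsets:
  assumes "S \<subseteq> {1..n}"
  shows "krawtchouk n k (card S) = (\<Sum>T | T \<subseteq> {1..n} \<and> card T = k. (- 1) ^ card (S \<inter> T))"
proof -
  let ?P = "{T. T \<subseteq> {1..n} \<and> card T = k}"
  have le: "card S \<le> n" using card_mono [OF _ assms] by simp
  have fin: "finite ?P" by simp
  have img: "(\<lambda>T. card (S \<inter> T)) ` ?P \<subseteq> {0..k}"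
  proof (rule image_subsetI)
    fix T assume T: "T \<in> ?P"
    then have "finite T" using finite_subset [of T "{1..n}"] by simp
    with T show "card (S \<inter> T) \<in> {0..k}" using card_mono [of T "S \<inter> T"] by simp
  qed
  have "(\<Sum>T\<in>?P. (- 1) ^ card (S \<inter> T) :: real)
      = (\<Sum>j=0..k. \<Sum>T | T \<in> ?P \<and> card (S \<inter> T) = j. (- 1) ^ card (S \<inter> T))"
    by (rule sum.group [OF fin _ img, symmetric]) simp
  also have "\<dots> = (\<Sum>j=0..k. (- 1) ^ j * (real (card S) gchoose j) * ((real n - card S) gchoose (k - j)))"
  proof (intro sum.cong refl)
    fix j assume "j \<in> {0..k}"
    then have "card {T \<in> ?P. card (S \<inter> T) = j} = (card S choose j) * (n - card S choose (k - j))"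
      using card_subsets_card_Int [of "{1..n}" S j k] assms by (simp add: conj_assoc)
    then show "(\<Sum>T | T \<in> ?P \<and> card (S \<inter> T) = j. (- 1) ^ card (S \<inter> T))
        = (- 1) ^ j * (real (card S) gchoose j) * ((real n - card S) gchoose (k - j))"
      \<comment> \<open>As \<open>card S \<le> n\<close>, the real difference is the cast of a
        natural number, so both generalized binomials are ordinary ones.\<close>
      using le by (simp add: binomial_gbinomial of_nat_diff)
  qed
  finally show ?thesis by (simp add: krawtchouk_def)
qed

section \<open>Fourier coefficients of the indicator of a code\<close>

lemma finite_cube: "finite (cube n)"
  by (auto simp: cube_def intro: finite_PiE)

lemma card_cube: "card (cube n) = 2 ^ n"
  by (simp add: cube_def card_PiE numeral_2_eq_2)

lemma cube_nonempty: "cube n \<noteq> {}"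
  using card_cube [of n] by force

lemma fourier_coeff_indicator:
  assumes "A \<subseteq> cube n"
  shows "fourier_coeff n (indicator A) S = (\<Sum>x\<in>A. chi S x) / 2 ^ n"
proof -
  have "(\<Sum>x\<in>cube n. indicator A x * chi S x) = (\<Sum>x\<in>A. chi S x)"
    using assms by (intro sum.mono_neutral_cong_right finite_cube) auto
  then show ?thesis
    by (simp add: fourier_coeff_def integral_pmf_of_set cube_nonempty finite_cube card_cube)
qed

text \<open>Squaring the coefficient gives a double sum over \<open>A\<close>; summing over
  \<open>S\<close> first then factors each term over the coordinates. Keeping \<open>T\<close>
  arbitrary makes the identity serve twice: \<open>T = {}\<close> yields Parseval, the
  \<open>k\<close>-subsets \<open>T\<close> yield Delsarte.\<close>

lemma sum_fourier_coeff_sq_twisted: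
  assumes "A \<subseteq> cube n"
  shows "(\<Sum>S\<in>Pow {1..n}. (fourier_coeff n (indicator A) S)\<^sup>2 * (- 1) ^ card (S \<inter> T))
       = (\<Sum>x\<in>A. \<Sum>y\<in>A. \<Prod>i\<in>{1..n}. 1 + x i * y i * (if i \<in> T then - 1 else 1)) / 4 ^ n"
proof -
  let ?\<sigma> = "\<lambda>i. if i \<in> T then - 1 else 1 :: real"
  have "(fourier_coeff n (indicator A) S)\<^sup>2 * (- 1) ^ card (S \<inter> T)
      = (\<Sum>x\<in>A. \<Sum>y\<in>A. \<Prod>i\<in>S. x i * y i * ?\<sigma> i) / 4 ^ n" if "S \<in> Pow {1..n}" for S
  proof -
    have "finite S" using that finite_subset by auto
    then have "prod ?\<sigma> S = (- 1) ^ card (S \<inter> T)"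
      by (simp add: prod.If_cases)
    then have "(\<Prod>i\<in>S. x i * y i * ?\<sigma> i) = chi S x * chi S y * (- 1) ^ card (S \<inter> T)" for x y
      by (simp add: prod.distrib chi_def)
    then show ?thesis
      by (simp add: fourier_coeff_indicator [OF assms] power2_eq_square sum_product
          sum_distrib_right [symmetric] power_mult_distrib [symmetric])
  qed
  then have "(\<Sum>S\<in>Pow {1..n}. (fourier_coeff n (indicator A) S)\<^sup>2 * (- 1) ^ card (S \<inter> T))
      = (\<Sum>S\<in>Pow {1..n}. \<Sum>x\<in>A. \<Sum>y\<in>A. \<Prod>i\<in>S. x i * y i * ?\<sigma> i) / 4 ^ n"
    by (simp add: sum_divide_distrib)
  also have "(\<Sum>S\<in>Pow {1..n}. \<Sum>x\<in>A. \<Sum>y\<in>A. \<Prod>i\<in>S. x i * y i * ?\<sigma> i)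
      = (\<Sum>x\<in>A. \<Sum>y\<in>A. \<Sum>S\<in>Pow {1..n}. \<Prod>i\<in>S. x i * y i * ?\<sigma> i)"
    by (subst sum.swap) (intro sum.cong refl sum.swap)
  finally show ?thesis
    by (simp add: sum_Pow_prod_eq_prod_one_plus)
qed

lemma cube_cases:
  assumes "x \<in> cube n" and "i \<in> {1..n}"
  shows "x i = - 1 \<or> x i = 1"
  using PiE_mem [OF assms [unfolded cube_def]] by simp

lemma sum_fourier_coeff_sq_twisted_nonneg:
  assumes "A \<subseteq> cube n"
  shows "0 \<le> (\<Sum>S\<in>Pow {1..n}. (fourier_coeff n (indicator A) S)\<^sup>2 * (- 1) ^ card (S \<inter> T))"
proof -
  \<comment> \<open>Each factor is 0 or 2, because the coordinates are signs.\<close>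
  have "0 \<le> 1 + x i * y i * (if i \<in> T then - 1 else 1)" if "x \<in> A" "y \<in> A" "i \<in> {1..n}" for x y i
  proof -
    have "x i = - 1 \<or> x i = 1" "y i = - 1 \<or> y i = 1"
      using cube_cases that assms by blast+
    then show ?thesis by auto
  qed
  then show ?thesis
    unfolding sum_fourier_coeff_sq_twisted [OF assms]
    by (intro divide_nonneg_nonneg sum_nonneg prod_nonneg) auto
qed

lemma prod_one_plus_cube:
  assumes "x \<in> cube n" and "y \<in> cube n"
  shows "(\<Prod>i\<in>{1..n}. 1 + x i * y i) = (if x = y then 2 ^ n else 0)"
proof (cases "x = y")
  case True
  have "1 + x i * x i = 2" if "i \<in> {1..n}" for i
    using cube_cases [OF assms(1) that] by auto
  then have "(\<Prod>i\<in>{1..n}. 1 + x i * x i) = (\<Prod>i\<in>{1..n}. 2)"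
    by (intro prod.cong) auto
  with True show ?thesis by simp
next
  case False
  \<comment> \<open>Points of the cube are extensional, so distinct ones differ at a coordinate in
    \<open>{1..n}\<close>; there \<open>x i * y i = - 1\<close> and the factor vanishes.\<close>
  then obtain i where i: "i \<in> {1..n}" "x i \<noteq> y i"
    using assms unfolding cube_def by (meson PiE_ext)
  then have "1 + x i * y i = 0"
    using cube_cases [OF assms(1) i(1)] cube_cases [OF assms(2) i(1)] by auto
  with i False show ?thesis by (auto intro!: prod_zero)
qed

text \<open>Only the diagonal pairs survive in the untwisted double sum, each contributing
  \<open>2 ^ n\<close>.\<close>

lemma parseval_indicator:
  assumes "A \<subseteq> cube n"
  shows "(\<Sum>S\<in>Pow {1..n}. (fourier_coeff n (indicator A) S)\<^sup>2) = code_density n A"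
proof -
  have fin: "finite A" using assms finite_cube finite_subset by blast
  have "(\<Sum>x\<in>A. \<Sum>y\<in>A. \<Prod>i\<in>{1..n}. 1 + x i * y i) = (\<Sum>x\<in>A. \<Sum>y\<in>A. if x = y then 2 ^ n else 0)"
    using assms by (intro sum.cong refl prod_one_plus_cube) auto
  also have "\<dots> = card A * 2 ^ n"
    using fin by simp
  finally have "(\<Sum>x\<in>A. \<Sum>y\<in>A. \<Prod>i\<in>{1..n}. 1 + x i * y i) / 4 ^ n = code_density n A"
    using power_mult_distrib [of "2::real" 2 n] by (simp add: code_density_def)
  then show ?thesis
    using sum_fourier_coeff_sq_twisted [OF assms, of "{}"] by simp
qed

section \<open>Mass and Delsarte inequalities of the dual distribution\<close>

lemma sum_fourier_weight:
  "(\<Sum>i=0..n. fourier_weight n i f * g i) = (\<Sum>S\<in>Pow {1..n}. (fourier_coeff n f S)\<^sup>2 * g (card S))"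
proof -
  have img: "card ` Pow {1..n} \<subseteq> {0..n}"
    using card_mono [of "{1..n}"] by fastforce
  have "(\<Sum>S\<in>Pow {1..n}. (fourier_coeff n f S)\<^sup>2 * g (card S))
      = (\<Sum>i=0..n. \<Sum>S | S \<in> Pow {1..n} \<and> card S = i. (fourier_coeff n f S)\<^sup>2 * g (card S))"
    by (rule sum.group [OF _ _ img, symmetric]) simp_all
  also have "\<dots> = (\<Sum>i=0..n. fourier_weight n i f * g i)"
    by (intro sum.cong refl) (simp add: fourier_weight_def sum_distrib_right)
  finally show ?thesis by simp
qed

lemma dual_distribution_nonneg: "0 \<le> dual_distribution n A k"
  by (simp add: dual_distribution_def fourier_weight_def sum_nonneg)

lemma code_density_pos:
  assumes "A \<subseteq> cube n" and "A \<noteq> {}"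
  shows "0 < code_density n A"
  using assms finite_subset [OF assms(1) finite_cube]
  by (simp add: code_density_def card_gt_0_iff)

lemma dual_distribution_0:
  assumes "A \<subseteq> cube n" and "A \<noteq> {}"
  shows "dual_distribution n A 0 = 1"
proof -
  \<comment> \<open>\<open>card\<close> is also 0 on infinite sets, hence the appeal to
    finiteness.\<close>
  have "card S = 0 \<longleftrightarrow> S = {}" if "S \<subseteq> {1..n}" for S
    using finite_subset [OF that] by simp
  then have "{S. S \<subseteq> {1..n} \<and> card S = 0} = {S. S \<subseteq> {1..n} \<and> S = {}}"
    by (intro Collect_cong conj_cong refl)
  also have "\<dots> = {{}}"
    by auto
  finally have "{S. S \<subseteq> {1..n} \<and> card S = 0} = {{}}" .
  then have "fourier_weight n 0 (indicator A) = (code_density n A)\<^sup>2"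
    by (simp add: fourier_weight_def fourier_coeff_indicator [OF assms(1)] chi_def code_density_def)
  with code_density_pos [OF assms] show ?thesis
    by (simp add: dual_distribution_def)
qed

lemma sum_dual_distribution:
  assumes "A \<subseteq> cube n" and "A \<noteq> {}"
  shows "(\<Sum>i=0..n. dual_distribution n A i) = 1 / code_density n A"
proof -
  have "(\<Sum>i=0..n. fourier_weight n i (indicator A)) = code_density n A"
    using sum_fourier_weight [of n "indicator A" "\<lambda>_. 1"] parseval_indicator [OF assms(1)] by simp
  then show ?thesis
    by (simp add: dual_distribution_def sum_divide_distrib [symmetric] power2_eq_square)
qed

text \<open>With the subset form of the Krawtchouk polynomial, exchanging the sums over
  \<open>S\<close> and \<open>T\<close> leaves a non-negative twisted sum for every
  \<open>T\<close>.\<close>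

lemma delsarte_inequality:
  assumes "A \<subseteq> cube n"
  shows "0 \<le> (\<Sum>i=0..n. dual_distribution n A i * krawtchouk n k i)"
proof -
  let ?F = "\<lambda>S. (fourier_coeff n (indicator A) S)\<^sup>2"
  have "(\<Sum>i=0..n. fourier_weight n i (indicator A) * krawtchouk n k i)
      = (\<Sum>S\<in>Pow {1..n}. ?F S * krawtchouk n k (card S))"
    by (rule sum_fourier_weight)
  also have "\<dots> = (\<Sum>S\<in>Pow {1..n}. \<Sum>T | T \<subseteq> {1..n} \<and> card T = k. ?F S * (- 1) ^ card (S \<inter> T))"
    by (intro sum.cong refl) (simp add: krawtchouk_eq_sum_subsets sum_distrib_left)
  also have "\<dots> = (\<Sum>T | T \<subseteq> {1..n} \<and> card T = k. \<Sum>S\<in>Pow {1..n}. ?F S * (- 1) ^ card (S \<inter> T))"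
    by (rule sum.swap)
  also have "\<dots> \<ge> 0"
    by (intro sum_nonneg sum_fourier_coeff_sq_twisted_nonneg assms)
  finally show ?thesis
    by (simp add: dual_distribution_def sum_divide_distrib [symmetric])
qed

section \<open>Weak duality\<close>

lemma lp_objective_le:
  assumes "n \<ge> 1" and "A \<subseteq> cube n" and "A \<noteq> {}" and "x \<in> lp_feasible n r"
  shows "lp_objective n (code_density n A) x
           \<le> (\<Sum>i=2..n. dual_distribution n A i * (omega n r 1 - omega n r i))"
proof -
  let ?Q = "dual_distribution n A" and ?K = "krawtchouk n"
  have split: "(\<Sum>i=0..n. g i) = g 0 + g 1 + (\<Sum>i=2..n. g i)" for g :: "nat \<Rightarrow> real"
    using assms(1) by (simp add: sum.atLeast_Suc_atMost numeral_2_eq_2)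
  \<comment> \<open>Dual feasibility. The value \<open>?Q 1\<close> is not a multiplier: the total
    mass expresses it through \<open>?Q 2\<close>, ..., \<open>?Q n\<close>, and substituting this
    into Delsarte's inequality produces exactly the coefficients of the objective.\<close>
  have dual: "(\<Sum>i=2..n. ?Q i * (?K k 1 - ?K k i)) \<le> ?K k 0 + ?K k 1 * (1 / code_density n A - 1)" for k
  proof -
    have total: "(\<Sum>i=2..n. ?Q i) = 1 / code_density n A - 1 - ?Q 1"
      using split [of ?Q] sum_dual_distribution [OF assms(2,3)] dual_distribution_0 [OF assms(2,3)]
      by simp
    have delsarte: "0 \<le> ?K k 0 + ?Q 1 * ?K k 1 + (\<Sum>i=2..n. ?Q i * ?K k i)"
      using delsarte_inequality [OF assms(2), of k] split [of "\<lambda>i. ?Q i * ?K k i"]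
        dual_distribution_0 [OF assms(2,3)] by simp
    have "(\<Sum>i=2..n. ?Q i * (?K k 1 - ?K k i))
        = ?K k 1 * (\<Sum>i=2..n. ?Q i) - (\<Sum>i=2..n. ?Q i * ?K k i)"
      by (simp add: right_diff_distrib sum_subtractf sum_distrib_left mult.commute)
    with delsarte show ?thesis
      unfolding total by (simp only: right_diff_distrib mult.commute [of "?Q 1"])
  qed
  \<comment> \<open>The dual constraints are weighted by \<open>x k \<ge> 0\<close>; after
    exchanging the sums, the primal constraints are weighted by \<open>?Q i \<ge> 0\<close>.\<close>
  have "lp_objective n (code_density n A) x
      \<le> - (\<Sum>k=1..n. (\<Sum>i=2..n. ?Q i * (?K k 1 - ?K k i)) * x k)"
    using assms(4) dual unfolding lp_objective_def lp_feasible_def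
    by (auto intro!: sum_mono mult_right_mono)
  also have "(\<Sum>k=1..n. (\<Sum>i=2..n. ?Q i * (?K k 1 - ?K k i)) * x k)
      = (\<Sum>i=2..n. ?Q i * (\<Sum>k=1..n. (?K k 1 - ?K k i) * x k))"
    unfolding sum_distrib_left sum_distrib_right by (subst sum.swap) (simp add: mult.assoc)
  also have "- \<dots> = (\<Sum>i=2..n. ?Q i * - (\<Sum>k=1..n. (?K k 1 - ?K k i) * x k))"
    by (simp add: sum_negf)
  also have "\<dots> \<le> (\<Sum>i=2..n. ?Q i * (omega n r 1 - omega n r i))"
  proof (intro sum_mono mult_left_mono dual_distribution_nonneg)
    fix i assume "i \<in> {2..n}"
    then have "- (omega n r 1 - omega n r i) \<le> (\<Sum>k=1..n. (?K k 1 - ?K k i) * x k)"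
      using assms(4) unfolding lp_feasible_def by blast
    then show "- (\<Sum>k=1..n. (?K k 1 - ?K k i) * x k) \<le> omega n r 1 - omega n r i"
      by linarith
  qed
  finally show ?thesis .
qed

theorem theorem11:
  fixes n r M :: nat and A :: "(nat \<Rightarrow> real) set" and \<alpha> :: real
  assumes "n \<ge> 1"
    and "r \<in> {1..n}"
    and "A \<subseteq> cube n"
    and "card A = M"
    and "M \<ge> 1"
    and "\<alpha> = real M / 2 ^ n"
  shows "ereal (\<Sum>i=2..n. dual_distribution n A i * (omega n r 1 - omega n r i))
           \<ge> Lambda_bar n \<alpha> r"
proof -
  have "A \<noteq> {}" and "\<alpha> = code_density n A"
    using assms by (auto simp: code_density_def)
  then show ?thesis
    \<comment> \<open>A bound at every feasible point bounds the supremum in \<open>ereal\<close>,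
      with no prior boundedness needed.\<close>
    using lp_objective_le [OF assms(1,3)] unfolding Lambda_bar_def by (auto intro!: SUP_least)
qed

end
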